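(* Let $\mathbb K$ be a field of characteristic zero and $E$ a finite-dimensional vector space over $\mathbb K$. Let $$\mathcal F(E)=T(E)/(\{[[x,y],z]\mid x,y,z\in E\}).$$ Then the homogeneous (neutral) meson algebra $D_0(E)$ is the quotient of $\mathcal F(E)$ by the two-sided ideal generated by the elements $x^3$ for $x\in E$, i.e. $$D_0(E)=\mathcal F(E)/(\{x^3\mid x\in E\}).$$
   Context: $T(E)$ is the tensor algebra of $E$, and $(I)$ denotes the two-sided ideal generated by a subset $I$. The bracket is the commutator $[a,b]=ab-ba$. The neutral (homogeneous) meson algebra is $D_0(E)=T(E)/(\{x\otimes y\otimes x\mid x,y\in E\})$, i.e. the unital associative algebra generated by $E$ with relations $xyx=0$ for all $x,y\in E$. The equality means that the identity map of $E$ induces an isomorphism of algebras (both being quotients of $T(E)$). *)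

theory Defs
  imports Complex_Main "HOL-Algebra.QuotRing" "HOL-Algebra.Module" "HOL-Library.Poly_Mapping"
begin

section \<open>Associative algebras over a field, and their quotients\<close>

text \<open>
  The field is a type of class \<^class>\<open>field\<close>. An algebra is a \<^type>\<open>module_ext\<close> record; the
  locale \<^locale>\<open>algebra\<close> of the library is not applicable because it requires commutativity.
\<close>

locale assoc_algebra = ring A for A :: "('k::field, 'a) module" (structure) +
  assumes smult_closed [simp]: "x \<in> carrier A \<Longrightarrow> c \<odot> x \<in> carrier A"
    and smult_add_left: "x \<in> carrier A \<Longrightarrow> (c + d) \<odot> x = c \<odot> x \<oplus> d \<odot> x"
    and smult_add_right:
      "\<lbrakk>x \<in> carrier A; y \<in> carrier A\<rbrakk> \<Longrightarrow> c \<odot> (x \<oplus> y) = c \<odot> x \<oplus> c \<odot> y"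
    and smult_smult: "x \<in> carrier A \<Longrightarrow> (c * d) \<odot> x = c \<odot> (d \<odot> x)"
    and smult_1 [simp]: "x \<in> carrier A \<Longrightarrow> 1 \<odot> x = x"
    and smult_mult_left:
      "\<lbrakk>x \<in> carrier A; y \<in> carrier A\<rbrakk> \<Longrightarrow> (c \<odot> x) \<otimes> y = c \<odot> (x \<otimes> y)"
    and smult_mult_right:
      "\<lbrakk>x \<in> carrier A; y \<in> carrier A\<rbrakk> \<Longrightarrow> x \<otimes> (c \<odot> y) = c \<odot> (x \<otimes> y)"

definition algebra_iso ::
    "('k, 'a) module \<Rightarrow> ('k, 'b) module \<Rightarrow> ('a \<Rightarrow> 'b) set" where
  "algebra_iso A B = {h \<in> ring_iso A B. \<forall>c. \<forall>x\<in>carrier A. h (c \<odot>\<^bsub>A\<^esub> x) = c \<odot>\<^bsub>B\<^esub> h x}"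

text \<open>
  The quotient of an algebra by the two-sided ideal generated by \<open>S\<close>: the quotient ring of the
  library with the induced scalar multiplication (which does not depend on representatives,
  see \<open>quot_algebra_smult_proj\<close> below).
\<close>

definition quot_algebra :: "('k, 'a) module \<Rightarrow> 'a set \<Rightarrow> ('k, 'a set) module" where
  "quot_algebra A S = (let Q = A Quot (Idl\<^bsub>A\<^esub> S) in
     \<lparr>carrier = carrier Q, mult = mult Q, one = one Q, zero = zero Q, add = add Q,
      smult = (\<lambda>c X. \<Union>x\<in>X. (Idl\<^bsub>A\<^esub> S) +>\<^bsub>A\<^esub> (c \<odot>\<^bsub>A\<^esub> x))\<rparr>)"

definition quot_proj :: "('k, 'a) module \<Rightarrow> 'a set \<Rightarrow> 'a \<Rightarrow> 'a set" where
  "quot_proj A S a = (Idl\<^bsub>A\<^esub> S) +>\<^bsub>A\<^esub> a"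

definition commutator :: "('k, 'a) module \<Rightarrow> 'a \<Rightarrow> 'a \<Rightarrow> 'a" where
  "commutator A a b = a \<otimes>\<^bsub>A\<^esub> b \<ominus>\<^bsub>A\<^esub> b \<otimes>\<^bsub>A\<^esub> a"


section \<open>The free associative algebra on the elements of a type\<close>

text \<open>
  Words form the free monoid under concatenation. It is written additively because the
  convolution product of \<^type>\<open>poly_mapping\<close> adds exponents; the type \<open>'e word \<Rightarrow>\<^sub>0 'k\<close> is
  then the monoid algebra of the free monoid.
\<close>

datatype 'a word = Word (letters: "'a list")

instantiation word :: (type) monoid_add
begin

definition zero_word :: "'a word" where "0 = Word []"

definition plus_word :: "'a word \<Rightarrow> 'a word \<Rightarrow> 'a word" where
  "v + w = Word (letters v @ letters w)"

instance
  by standard (simp_all add: zero_word_def plus_word_def)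

end

definition free_algebra :: "('k::field, 'e word \<Rightarrow>\<^sub>0 'k) module" where
  "free_algebra = \<lparr>carrier = UNIV, mult = (*), one = 1, zero = 0, add = (+),
     smult = (\<lambda>c p. Poly_Mapping.single 0 c * p)\<rparr>"

definition free_gen :: "'e \<Rightarrow> 'e word \<Rightarrow>\<^sub>0 'k::field" where
  "free_gen x = Poly_Mapping.single (Word [x]) 1"


section \<open>The tensor algebra\<close>

text \<open>
  The vector space \<open>E\<close> is the type \<open>'e\<close> with scalar multiplication \<open>scale\<close>. Its tensor algebra is
  the free algebra on the set \<open>E\<close> modulo the relations saying that \<open>E \<rightarrow> T(E)\<close> is linear. In
  word length \<open>n\<close> these relations are exactly the multilinearity relations that define the
  \<open>n\<close>-th tensor power of \<open>E\<close>, the word \<open>x\<^sub>1 \<dots> x\<^sub>n\<close> being the tensor \<open>x\<^sub>1 \<otimes> \<dots> \<otimes> x\<^sub>n\<close>.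
\<close>

definition linearity_relations ::
    "('k::field \<Rightarrow> 'e::ab_group_add \<Rightarrow> 'e) \<Rightarrow> ('e word \<Rightarrow>\<^sub>0 'k) set" where
  "linearity_relations scale =
     {free_gen (x + y) - (free_gen x + free_gen y) | x y. True} \<union>
     {free_gen (scale c x) - c \<odot>\<^bsub>free_algebra\<^esub> free_gen x | c x. True}"

definition tensor_algebra ::
    "('k::field \<Rightarrow> 'e::ab_group_add \<Rightarrow> 'e) \<Rightarrow> ('k, ('e word \<Rightarrow>\<^sub>0 'k) set) module" where
  "tensor_algebra scale = quot_algebra free_algebra (linearity_relations scale)"

definition tensor_gen ::
    "('k::field \<Rightarrow> 'e::ab_group_add \<Rightarrow> 'e) \<Rightarrow> 'e \<Rightarrow> ('e word \<Rightarrow>\<^sub>0 'k) set" where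
  "tensor_gen scale x = quot_proj free_algebra (linearity_relations scale) (free_gen x)"


section \<open>The algebras under consideration\<close>

definition meson_relations ::
    "('k::field \<Rightarrow> 'e::ab_group_add \<Rightarrow> 'e) \<Rightarrow> ('e word \<Rightarrow>\<^sub>0 'k) set set" where
  "meson_relations scale =
     {tensor_gen scale x \<otimes>\<^bsub>tensor_algebra scale\<^esub> tensor_gen scale y
        \<otimes>\<^bsub>tensor_algebra scale\<^esub> tensor_gen scale x | x y. True}"

definition meson_algebra ::
    "('k::field \<Rightarrow> 'e::ab_group_add \<Rightarrow> 'e) \<Rightarrow> ('k, ('e word \<Rightarrow>\<^sub>0 'k) set set) module" where
  "meson_algebra scale = quot_algebra (tensor_algebra scale) (meson_relations scale)"

definition meson_proj ::
    "('k::field \<Rightarrow> 'e::ab_group_add \<Rightarrow> 'e) \<Rightarrow>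
     ('e word \<Rightarrow>\<^sub>0 'k) set \<Rightarrow> ('e word \<Rightarrow>\<^sub>0 'k) set set" where
  "meson_proj scale = quot_proj (tensor_algebra scale) (meson_relations scale)"

definition F_relations ::
    "('k::field \<Rightarrow> 'e::ab_group_add \<Rightarrow> 'e) \<Rightarrow> ('e word \<Rightarrow>\<^sub>0 'k) set set" where
  "F_relations scale =
     {commutator (tensor_algebra scale)
        (commutator (tensor_algebra scale) (tensor_gen scale x) (tensor_gen scale y))
        (tensor_gen scale z) | x y z. True}"

definition F_algebra ::
    "('k::field \<Rightarrow> 'e::ab_group_add \<Rightarrow> 'e) \<Rightarrow> ('k, ('e word \<Rightarrow>\<^sub>0 'k) set set) module" where
  "F_algebra scale = quot_algebra (tensor_algebra scale) (F_relations scale)"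

definition F_proj ::
    "('k::field \<Rightarrow> 'e::ab_group_add \<Rightarrow> 'e) \<Rightarrow>
     ('e word \<Rightarrow>\<^sub>0 'k) set \<Rightarrow> ('e word \<Rightarrow>\<^sub>0 'k) set set" where
  "F_proj scale = quot_proj (tensor_algebra scale) (F_relations scale)"

definition F_cubes ::
    "('k::field \<Rightarrow> 'e::ab_group_add \<Rightarrow> 'e) \<Rightarrow> ('e word \<Rightarrow>\<^sub>0 'k) set set set" where
  "F_cubes scale =
     {F_proj scale (tensor_gen scale x) [^]\<^bsub>F_algebra scale\<^esub> (3::nat) | x. True}"


section \<open>Well-definedness\<close>

lemma quot_algebra_simps:
  "carrier (quot_algebra A S) = carrier (A Quot (Idl\<^bsub>A\<^esub> S))"
  "mult (quot_algebra A S) = mult (A Quot (Idl\<^bsub>A\<^esub> S))"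
  "one (quot_algebra A S) = one (A Quot (Idl\<^bsub>A\<^esub> S))"
  "zero (quot_algebra A S) = zero (A Quot (Idl\<^bsub>A\<^esub> S))"
  "add (quot_algebra A S) = add (A Quot (Idl\<^bsub>A\<^esub> S))"
  by (simp_all add: quot_algebra_def Let_def)

lemma ring_cong_record:
  fixes R :: "('a, 'm) ring_scheme" and S :: "('a, 'n) ring_scheme"
  assumes "ring R" "carrier S = carrier R" "mult S = mult R" "one S = one R"
    "zero S = zero R" "add S = add R"
  shows "ring S"
proof -
  interpret R: ring R by fact
  have "abelian_group S"
  proof (rule abelian_groupI)
    show "\<exists>y\<in>carrier S. y \<oplus>\<^bsub>S\<^esub> x = \<zero>\<^bsub>S\<^esub>" if "x \<in> carrier S" for x
      using that R.a_inv_closed[of x] R.l_neg[of x] by (auto simp: assms)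
  qed (auto simp: assms R.a_ac)
  moreover have "Group.monoid S"
    by (rule monoidI) (auto simp: assms R.m_assoc)
  ultimately show ?thesis
    by (rule ringI) (auto simp: assms R.l_distr R.r_distr)
qed

context assoc_algebra
begin

context
  fixes S
  assumes S: "S \<subseteq> carrier A"
begin

interpretation I: ideal "Idl S" A
  by (rule genideal_ideal[OF S])

lemma quot_algebra_carrier: "carrier (quot_algebra A S) = quot_proj A S ` carrier A"
  by (auto simp: quot_algebra_simps quot_proj_def FactRing_def A_RCOSETS_def RCOSETS_def
      a_r_coset_def)

lemma quot_algebra_ring: "ring (quot_algebra A S)"
  by (rule ring_cong_record[OF I.quotient_is_ring]) (simp_all add: quot_algebra_simps)

lemma quot_algebra_mult_proj:
  "\<lbrakk>x \<in> carrier A; y \<in> carrier A\<rbrakk> \<Longrightarrow>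
     quot_proj A S x \<otimes>\<^bsub>quot_algebra A S\<^esub> quot_proj A S y = quot_proj A S (x \<otimes> y)"
  by (simp add: quot_algebra_simps quot_proj_def FactRing_def I.rcoset_mult_add)

lemma quot_algebra_add_proj:
  "\<lbrakk>x \<in> carrier A; y \<in> carrier A\<rbrakk> \<Longrightarrow>
     quot_proj A S x \<oplus>\<^bsub>quot_algebra A S\<^esub> quot_proj A S y = quot_proj A S (x \<oplus> y)"
  by (simp add: quot_algebra_simps quot_proj_def FactRing_def I.a_rcos_sum)

lemma quot_algebra_smult_proj:
  assumes x: "x \<in> carrier A"
  shows "c \<odot>\<^bsub>quot_algebra A S\<^esub> quot_proj A S x = quot_proj A S (c \<odot> x)"
proof -
  have *: "Idl S +> (c \<odot> y) = Idl S +> (c \<odot> x)" if y: "y \<in> Idl S +> x" for y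
  proof -
    from y obtain i where i: "i \<in> Idl S" "y = i \<oplus> x"
      by (auto simp: a_r_coset_def r_coset_def)
    have iA: "i \<in> carrier A" using i(1) by (rule I.a_Hcarr)
    have "c \<odot> i = (c \<odot> \<one>) \<otimes> i" using iA by (simp add: smult_mult_left)
    then have ci: "c \<odot> i \<in> Idl S" using i(1) I.I_l_closed by simp
    have "c \<odot> y = c \<odot> i \<oplus> c \<odot> x" using iA x by (simp add: i(2) smult_add_right)
    then have "c \<odot> y \<in> Idl S +> (c \<odot> x)" using ci by (auto simp: a_r_coset_def r_coset_def)
    then show ?thesis using I.a_repr_independence'[of "c \<odot> y" "c \<odot> x"] x
      by simp
  qed
  have "x \<in> Idl S +> x" using I.a_rcos_self x by simp
  then show ?thesis
    unfolding quot_proj_def by (simp add: quot_algebra_def Let_def) (use * in blast)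
qed

lemma quot_algebra_assoc_algebra: "assoc_algebra (quot_algebra A S)"
proof -
  interpret Q: ring "quot_algebra A S" by (rule quot_algebra_ring)
  show ?thesis
    by unfold_locales
      (auto simp: quot_algebra_carrier quot_algebra_smult_proj quot_algebra_mult_proj
        quot_algebra_add_proj smult_add_left smult_add_right smult_smult smult_mult_left
        smult_mult_right)
qed

end

end

lemma single_0_commute:
  fixes p :: "'e word \<Rightarrow>\<^sub>0 'k::field"
  shows "p * Poly_Mapping.single 0 c = Poly_Mapping.single 0 c * p"
proof (induction p rule: update_induct)
  case const
  show ?case by simp
next
  case (update f a b)
  have "Poly_Mapping.update a b f = f + Poly_Mapping.single a b"
    using update(1)
    by (intro poly_mapping_eqI)
      (auto simp: lookup_update lookup_add lookup_single when_def in_keys_iff)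
  then show ?case
    by (simp add: update.IH distrib_left distrib_right mult_single mult.commute)
qed

lemma free_algebra_simps [simp]:
  "carrier free_algebra = UNIV" "mult free_algebra = (*)" "one free_algebra = 1"
  "zero free_algebra = 0" "add free_algebra = (+)"
  "c \<odot>\<^bsub>free_algebra\<^esub> p = Poly_Mapping.single 0 c * p"
  by (simp_all add: free_algebra_def)

lemma assoc_algebra_free_algebra:
  "assoc_algebra (free_algebra :: ('k::field, 'e word \<Rightarrow>\<^sub>0 'k) module)"
proof -
  have "abelian_group (free_algebra :: ('k, 'e word \<Rightarrow>\<^sub>0 'k) module)"
    by (rule abelian_groupI) (auto simp: ac_simps intro: exI[of _ "- x" for x])
  moreover have "Group.monoid (free_algebra :: ('k, 'e word \<Rightarrow>\<^sub>0 'k) module)"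
    by (rule monoidI) (auto simp: mult.assoc)
  ultimately interpret ring "free_algebra :: ('k, 'e word \<Rightarrow>\<^sub>0 'k) module"
    by (rule ringI) (auto simp: distrib_left distrib_right)
  have "p * (Poly_Mapping.single 0 c * q) = Poly_Mapping.single 0 c * (p * q)"
    for p q :: "'e word \<Rightarrow>\<^sub>0 'k" and c
    by (metis mult.assoc single_0_commute)
  then show ?thesis
    by unfold_locales
      (simp_all add: distrib_left distrib_right single_add mult_single mult.assoc[symmetric])
qed

lemma assoc_algebra_tensor_algebra: "assoc_algebra (tensor_algebra scale)"
  unfolding tensor_algebra_def
  by (rule assoc_algebra.quot_algebra_assoc_algebra[OF assoc_algebra_free_algebra]) simp

lemma tensor_gen_closed [simp]: "tensor_gen scale x \<in> carrier (tensor_algebra scale)"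
  unfolding tensor_algebra_def tensor_gen_def
  by (simp add: assoc_algebra.quot_algebra_carrier[OF assoc_algebra_free_algebra])

lemma assoc_algebra_meson_algebra: "assoc_algebra (meson_algebra scale)"
proof -
  interpret T: assoc_algebra "tensor_algebra scale" by (rule assoc_algebra_tensor_algebra)
  show ?thesis
    unfolding meson_algebra_def
    by (rule T.quot_algebra_assoc_algebra) (auto simp: meson_relations_def)
qed

lemma F_relations_closed: "F_relations scale \<subseteq> carrier (tensor_algebra scale)"
proof -
  interpret T: assoc_algebra "tensor_algebra scale" by (rule assoc_algebra_tensor_algebra)
  show ?thesis by (auto simp: F_relations_def commutator_def)
qed

lemma assoc_algebra_F_algebra: "assoc_algebra (F_algebra scale)"
  unfolding F_algebra_def
  by (rule assoc_algebra.quot_algebra_assoc_algebra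
      [OF assoc_algebra_tensor_algebra F_relations_closed])

lemma F_cubes_closed: "F_cubes scale \<subseteq> carrier (F_algebra scale)"
proof -
  interpret F: assoc_algebra "F_algebra scale" by (rule assoc_algebra_F_algebra)
  have "F_proj scale (tensor_gen scale x) \<in> carrier (F_algebra scale)" for x
    unfolding F_algebra_def F_proj_def
    by (simp add: assoc_algebra.quot_algebra_carrier
        [OF assoc_algebra_tensor_algebra F_relations_closed])
  then show ?thesis by (auto simp: F_cubes_def)
qed

end

theory Submission
  imports Defs
begin

text \<open>
  Both algebras are quotients of \<open>T(E)\<close>, so it suffices to compare ideals of \<open>T(E)\<close>. Polarising
  \<open>x y x = 0\<close> in \<open>x\<close> gives \<open>x y z + z y x = 0\<close>, and \<open>[[x, y], z]\<close> is a difference of two such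
  expressions. Conversely,
  \<open>6 x y x = (x + y)\<^sup>3 - (x - y)\<^sup>3 - 2 y\<^sup>3 + 2 [[x, y], x]\<close>, and \<open>6\<close> is invertible.
\<close>

section \<open>Ideals, iterated quotients and the first isomorphism theorem for associative
  algebras\<close>

lemma (in ring_hom_ring) ideal_image:
  assumes surj: "h ` carrier R = carrier S" and I: "ideal I R"
  shows "ideal (h ` I) S"
proof -
  interpret I: ideal I R by (rule I)
  have "group_hom (add_monoid R) (add_monoid S) h"
    by (rule a_group_hom)
  then have "subgroup (h ` I) (add_monoid S)"
    by (rule group_hom.subgroup_img_is_subgroup) (rule I.a_subgroup)
  then show ?thesis
  proof (rule idealI[OF S.ring_axioms])
    fix a y
    assume "a \<in> h ` I" "y \<in> carrier S"
    then obtain i x where "i \<in> I" "a = h i" "x \<in> carrier R" "y = h x"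
      using surj by (metis imageE)
    moreover from this have "h (x \<otimes> i) = y \<otimes>\<^bsub>S\<^esub> a" "h (i \<otimes> x) = a \<otimes>\<^bsub>S\<^esub> y"
      by (simp_all add: I.Icarr)
    ultimately show "y \<otimes>\<^bsub>S\<^esub> a \<in> h ` I" "a \<otimes>\<^bsub>S\<^esub> y \<in> h ` I"
      by (metis I.I_l_closed imageI, metis I.I_r_closed imageI)
  qed
qed

context assoc_algebra
begin

lemma quot_proj_eq_zero_iff:
  assumes "S \<subseteq> carrier A" "x \<in> carrier A"
  shows "quot_proj A S x = \<zero>\<^bsub>quot_algebra A S\<^esub> \<longleftrightarrow> x \<in> Idl S"
proof -
  have "ideal (Idl S) A"
    by (rule genideal_ideal[OF assms(1)])
  then show ?thesis
    using assms(2)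
    by (simp add: quot_proj_def quot_algebra_simps FactRing_def ideal.rcos_const_imp_mem)
      (metis a_rcos_zero ideal.rcos_const_imp_mem)
qed

lemma quot_proj_ring_hom_ring:
  assumes S: "S \<subseteq> carrier A"
  shows "ring_hom_ring A (quot_algebra A S) (quot_proj A S)"
proof (rule ring_hom_ringI[OF ring_axioms quot_algebra_ring[OF S]])
  show "quot_proj A S \<one> = \<one>\<^bsub>quot_algebra A S\<^esub>"
    by (simp add: quot_proj_def quot_algebra_simps FactRing_def)
qed (auto simp: S quot_algebra_carrier quot_algebra_mult_proj quot_algebra_add_proj)

text \<open>Third isomorphism theorem in kernel form, which turns a quotient of a quotient into one
  quotient of \<open>A\<close>. Both inclusions come from minimality of generated ideals: the image
  of \<open>Idl (S \<union> C)\<close> in \<open>Q\<close> is an ideal containing the image of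
  \<open>C\<close>, and the preimage of the ideal generated in \<open>Q\<close> is an ideal
  containing \<open>S\<close> and \<open>C\<close>.\<close>

lemma kernel_quot_quot:
  assumes S: "S \<subseteq> carrier A" and C: "C \<subseteq> carrier A"
  defines "Q \<equiv> quot_algebra A S"
  shows "a_kernel A (quot_algebra Q (quot_proj A S ` C))
      (\<lambda>x. quot_proj Q (quot_proj A S ` C) (quot_proj A S x)) = Idl (S \<union> C)"
proof -
  let ?p = "quot_proj A S"
  interpret Q: assoc_algebra Q
    unfolding Q_def by (rule quot_algebra_assoc_algebra[OF S])
  interpret p: ring_hom_ring A Q ?p
    unfolding Q_def by (rule quot_proj_ring_hom_ring[OF S])
  have carrier_Q: "?p ` carrier A = carrier Q"
    unfolding Q_def by (rule quot_algebra_carrier[OF S, symmetric])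
  have pC: "?p ` C \<subseteq> carrier Q"
    using C carrier_Q by blast
  interpret I: ideal "Idl (S \<union> C)" A
    using S C by (intro genideal_ideal) simp
  have SC: "S \<union> C \<subseteq> Idl (S \<union> C)"
    using S C by (intro genideal_self) simp
  have IdlS: "Idl S \<subseteq> Idl (S \<union> C)"
    using SC by (intro genideal_minimal I.ideal_axioms) simp
  have "x \<in> Idl (S \<union> C) \<longleftrightarrow> ?p x \<in> Idl\<^bsub>Q\<^esub> (?p ` C)" if x: "x \<in> carrier A" for x
  proof
    assume "?p x \<in> Idl\<^bsub>Q\<^esub> (?p ` C)"
    also have "Idl\<^bsub>Q\<^esub> (?p ` C) \<subseteq> ?p ` (Idl (S \<union> C))"
      using SC by (intro Q.genideal_minimal p.ideal_image carrier_Q I.ideal_axioms) blast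
    finally obtain y where y: "y \<in> Idl (S \<union> C)" "?p x = ?p y"
      by blast
    have yA: "y \<in> carrier A"
      using y(1) by (rule I.Icarr)
    \<comment> \<open>The elements \<open>x\<close> and \<open>y\<close> have the same coset, so
      they differ by an element of \<open>Idl S\<close>, which lies in the larger ideal; adding
      \<open>y\<close> back recovers \<open>x\<close>.\<close>
    have "x \<ominus> y \<in> Idl S"
      using y(2) x yA quotient_eq_iff_same_a_r_cos[OF genideal_ideal[OF S]]
      by (simp add: quot_proj_def)
    then have "x \<ominus> y \<oplus> y \<in> Idl (S \<union> C)"
      using IdlS y(1) by (intro I.a_closed) auto
    then show "x \<in> Idl (S \<union> C)"
      using x yA by (simp add: minus_eq a_assoc l_neg)
  next
    interpret V: ideal "{r \<in> carrier A. ?p r \<in> Idl\<^bsub>Q\<^esub> (?p ` C)}" A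
      by (rule p.ideal_vimage[OF Q.genideal_ideal[OF pC]])
    assume "x \<in> Idl (S \<union> C)"
    moreover have "Idl (S \<union> C) \<subseteq> {r \<in> carrier A. ?p r \<in> Idl\<^bsub>Q\<^esub> (?p ` C)}"
    proof (rule genideal_minimal[OF V.ideal_axioms], safe)
      fix s assume s: "s \<in> S"
      then show sA: "s \<in> carrier A" using S by blast
      have "?p s = \<zero>\<^bsub>Q\<^esub>"
        using quot_proj_eq_zero_iff[OF S sA] genideal_self[OF S] s by (auto simp: Q_def)
      then show "?p s \<in> Idl\<^bsub>Q\<^esub> (?p ` C)"
        using additive_subgroup.zero_closed[OF ideal.axioms(1)[OF Q.genideal_ideal[OF pC]]] by simp
    next
      fix c assume "c \<in> C"
      then show "c \<in> carrier A" "?p c \<in> Idl\<^bsub>Q\<^esub> (?p ` C)"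
        using C Q.genideal_self[OF pC] by blast+
    qed
    ultimately show "?p x \<in> Idl\<^bsub>Q\<^esub> (?p ` C)" by blast
  qed
  then have "quot_proj Q (?p ` C) (?p x) = \<zero>\<^bsub>quot_algebra Q (?p ` C)\<^esub> \<longleftrightarrow> x \<in> Idl (S \<union> C)"
    if "x \<in> carrier A" for x
    using that Q.quot_proj_eq_zero_iff[OF pC p.hom_closed] by simp
  then show ?thesis
    unfolding a_kernel_def' using I.Icarr by blast
qed

text \<open>First isomorphism theorem. The kernel is prescribed as \<open>Idl S\<close> for a set
  \<open>S\<close> of choice, so a homomorphism whose kernel arises from other generators can still
  be factored through the quotient by \<open>S\<close>.\<close>

lemma quot_algebra_iso:
  assumes S: "S \<subseteq> carrier A" and B: "ring B" and h: "h \<in> ring_hom A B"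
    and surj: "h ` carrier A = carrier B"
    and smult: "\<And>c x. x \<in> carrier A \<Longrightarrow> h (c \<odot> x) = c \<odot>\<^bsub>B\<^esub> h x"
    and ker: "a_kernel A B h = Idl S"
  shows "\<exists>\<phi> \<in> algebra_iso (quot_algebra A S) B. \<forall>x \<in> carrier A. \<phi> (quot_proj A S x) = h x"
proof -
  interpret h: ring_hom_ring A B h
    by (rule ring_hom_ringI2[OF ring_axioms B h])
  let ?\<phi> = "\<lambda>X. the_elem (h ` X)"
  have \<phi>: "?\<phi> (quot_proj A S x) = h x" if "x \<in> carrier A" for x
    using h.the_elem_simp[OF that] by (simp add: ker quot_proj_def)
  have "?\<phi> \<in> ring_iso (A Quot Idl S) B"
    using h.FactRing_iso_set[OF surj] by (simp add: ker)
  then have "?\<phi> \<in> ring_iso (quot_algebra A S) B"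
    by (simp add: ring_iso_def ring_hom_def quot_algebra_simps)
  moreover have "?\<phi> (c \<odot>\<^bsub>quot_algebra A S\<^esub> X) = c \<odot>\<^bsub>B\<^esub> ?\<phi> X"
    if "X \<in> carrier (quot_algebra A S)" for c X
    using that by (auto simp: S quot_algebra_carrier quot_algebra_smult_proj \<phi> smult)
  ultimately show ?thesis
    using \<phi> by (auto simp: algebra_iso_def)
qed

end

section \<open>Computing in the tensor algebra through representatives in the free algebra\<close>

definition tensor_proj ::
    "('k::field \<Rightarrow> 'e::ab_group_add \<Rightarrow> 'e) \<Rightarrow> ('e word \<Rightarrow>\<^sub>0 'k) \<Rightarrow> ('e word \<Rightarrow>\<^sub>0 'k) set" where
  "tensor_proj scale = quot_proj free_algebra (linearity_relations scale)"

lemma tensor_proj_ring_hom_ring: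
  "ring_hom_ring free_algebra (tensor_algebra scale) (tensor_proj scale)"
  unfolding tensor_proj_def tensor_algebra_def
  by (rule assoc_algebra.quot_proj_ring_hom_ring[OF assoc_algebra_free_algebra]) simp

lemma free_algebra_a_inv:
  fixes p :: "'e word \<Rightarrow>\<^sub>0 'k::field"
  shows "\<ominus>\<^bsub>free_algebra\<^esub> p = - p"
proof -
  interpret assoc_algebra "free_algebra :: ('k, 'e word \<Rightarrow>\<^sub>0 'k) module"
    by (rule assoc_algebra_free_algebra)
  show ?thesis using minus_equality[of "- p" p] by simp
qed

text \<open>The free algebra lives on a whole type with type class ring operations. Read from right
  to left, these rules move an identity of \<open>tensor_algebra scale\<close> there, where
  \<open>algebra_simps\<close> can expand it.\<close>

lemma
  shows tensor_proj_closed: "tensor_proj scale p \<in> carrier (tensor_algebra scale)"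
    and tensor_proj_mult: "tensor_proj scale (p * q) =
      tensor_proj scale p \<otimes>\<^bsub>tensor_algebra scale\<^esub> tensor_proj scale q"
    and tensor_proj_add: "tensor_proj scale (p + q) =
      tensor_proj scale p \<oplus>\<^bsub>tensor_algebra scale\<^esub> tensor_proj scale q"
    and tensor_proj_diff: "tensor_proj scale (p - q) =
      tensor_proj scale p \<ominus>\<^bsub>tensor_algebra scale\<^esub> tensor_proj scale q"
proof -
  interpret ring_hom_ring free_algebra "tensor_algebra scale" "tensor_proj scale"
    by (rule tensor_proj_ring_hom_ring)
  show "tensor_proj scale p \<in> carrier (tensor_algebra scale)"
    using hom_closed[of p] by simp
  show "tensor_proj scale (p * q) =
      tensor_proj scale p \<otimes>\<^bsub>tensor_algebra scale\<^esub> tensor_proj scale q"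
    using hom_mult[of p q] by simp
  show "tensor_proj scale (p + q) =
      tensor_proj scale p \<oplus>\<^bsub>tensor_algebra scale\<^esub> tensor_proj scale q"
    using hom_add[of p q] by simp
  show "tensor_proj scale (p - q) =
      tensor_proj scale p \<ominus>\<^bsub>tensor_algebra scale\<^esub> tensor_proj scale q"
    using hom_add[of p "- q"] hom_a_inv[of q] by (simp add: free_algebra_a_inv a_minus_def)
qed

lemma tensor_gen_eq_proj: "tensor_gen scale x = tensor_proj scale (free_gen x)"
  by (simp add: tensor_gen_def tensor_proj_def)

text \<open>In the free algebra \<open>x + y\<close> is a letter of its own, unrelated to
  \<open>x\<close> and \<open>y\<close>. Only after projection does it become a sum, because the
  difference is a linearity relation; this is what makes polarisation possible.\<close>

lemma tensor_proj_gen_add: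
  fixes scale :: "'k::field \<Rightarrow> 'e::ab_group_add \<Rightarrow> 'e"
  shows "tensor_proj scale (free_gen (x + y)) = tensor_proj scale (free_gen x + free_gen y)"
proof -
  interpret free: assoc_algebra "free_algebra :: ('k, 'e word \<Rightarrow>\<^sub>0 'k) module"
    by (rule assoc_algebra_free_algebra)
  have "free_gen (x + y) - (free_gen x + free_gen y) \<in> Idl\<^bsub>free_algebra\<^esub> linearity_relations scale"
    by (rule subsetD[OF free.genideal_self]) (auto simp: linearity_relations_def)
  then show ?thesis
    using free.quotient_eq_iff_same_a_r_cos[OF free.genideal_ideal[of "linearity_relations scale"],
        of "free_gen (x + y)" "free_gen x + free_gen y"]
    by (simp add: tensor_proj_def quot_proj_def a_minus_def free_algebra_a_inv
        del: minus_add_distrib)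
qed

text \<open>The bracketing is the one left by distributing
  \<open>(x y - y x) z - z (x y - y x)\<close> without reassociating.\<close>

lemma F_relations_eq:
  "F_relations scale = {tensor_proj scale
     (free_gen x * free_gen y * free_gen z - free_gen y * free_gen x * free_gen z -
      (free_gen z * (free_gen x * free_gen y) - free_gen z * (free_gen y * free_gen x))) |
     x y z. True}"
proof -
  have "commutator (tensor_algebra scale)
      (commutator (tensor_algebra scale) (tensor_gen scale x) (tensor_gen scale y))
      (tensor_gen scale z) =
    tensor_proj scale (free_gen x * free_gen y * free_gen z - free_gen y * free_gen x * free_gen z -
      (free_gen z * (free_gen x * free_gen y) - free_gen z * (free_gen y * free_gen x)))" for x y z
    by (simp add: commutator_def tensor_gen_eq_proj left_diff_distrib right_diff_distrib
        flip: tensor_proj_mult tensor_proj_diff)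
  then show ?thesis
    by (simp add: F_relations_def)
qed

lemma meson_relations_eq:
  "meson_relations scale =
     {tensor_proj scale (free_gen x * free_gen y * free_gen x) | x y. True}"
  by (simp add: meson_relations_def tensor_gen_eq_proj tensor_proj_mult)

text \<open>The cubes are lifted from \<open>F_algebra scale\<close> to the tensor algebra, so that
  \<open>F_cubes scale\<close> is the image of a subset of the tensor algebra, as
  \<open>kernel_quot_quot\<close> requires.\<close>

definition T_cubes ::
    "('k::field \<Rightarrow> 'e::ab_group_add \<Rightarrow> 'e) \<Rightarrow> ('e word \<Rightarrow>\<^sub>0 'k) set set" where
  "T_cubes scale = range (\<lambda>x. tensor_proj scale (free_gen x * free_gen x * free_gen x))"

lemma T_cubes_closed: "T_cubes scale \<subseteq> carrier (tensor_algebra scale)"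
  by (auto simp: T_cubes_def tensor_proj_closed)

lemma meson_relations_closed: "meson_relations scale \<subseteq> carrier (tensor_algebra scale)"
  by (auto simp: meson_relations_eq tensor_proj_closed)

lemma F_cubes_eq: "F_cubes scale = F_proj scale ` T_cubes scale"
proof -
  interpret T: assoc_algebra "tensor_algebra scale" by (rule assoc_algebra_tensor_algebra)
  interpret F: assoc_algebra "F_algebra scale" by (rule assoc_algebra_F_algebra)
  interpret p: ring_hom_ring "tensor_algebra scale" "F_algebra scale" "F_proj scale"
    unfolding F_algebra_def F_proj_def
    by (rule T.quot_proj_ring_hom_ring[OF F_relations_closed])
  have "F_proj scale (tensor_gen scale x) [^]\<^bsub>F_algebra scale\<^esub> (3::nat) =
      F_proj scale (tensor_proj scale (free_gen x * free_gen x * free_gen x))" for x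
    by (simp add: numeral_3_eq_3 tensor_gen_eq_proj tensor_proj_mult tensor_proj_closed)
  then show ?thesis
    by (auto simp: F_cubes_def T_cubes_def)
qed

section \<open>Equality of the two ideals of the tensor algebra\<close>

lemma F_relations_cubes_subset_meson_ideal:
  "F_relations scale \<union> T_cubes scale \<subseteq> Idl\<^bsub>tensor_algebra scale\<^esub> meson_relations scale"
proof -
  interpret T: assoc_algebra "tensor_algebra scale" by (rule assoc_algebra_tensor_algebra)
  interpret J: ideal "Idl\<^bsub>tensor_algebra scale\<^esub> meson_relations scale" "tensor_algebra scale"
    by (rule T.genideal_ideal[OF meson_relations_closed])
  \<comment> \<open>\<open>P\<close> pulls membership in the ideal back to representatives, so that
    the closure rules combine with arithmetic in the free algebra.\<close>
  define P where "P p \<longleftrightarrow> tensor_proj scale p \<in> Idl\<^bsub>tensor_algebra scale\<^esub> meson_relations scale" for p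
  have diff: "P (p - q)" if "P p" "P q" for p q
    using that by (simp add: P_def tensor_proj_diff a_minus_def)
  have sandwich: "P (free_gen x * free_gen y * free_gen x)" for x y
    unfolding P_def
    by (rule subsetD[OF T.genideal_self[OF meson_relations_closed]]) (auto simp: meson_relations_eq)
  have polar: "P (free_gen x * free_gen y * free_gen z + free_gen z * free_gen y * free_gen x)" for x y z
  proof -
    \<comment> \<open>The relation for \<open>x + z\<close> and \<open>y\<close>, minus those for
      \<open>x\<close>, \<open>y\<close> and for \<open>z\<close>, \<open>y\<close>, leaves only the
      mixed terms.\<close>
    have "P ((free_gen x + free_gen z) * free_gen y * (free_gen x + free_gen z))"
      using sandwich[of "x + z" y] by (simp add: P_def tensor_proj_mult tensor_proj_gen_add)
    from diff[OF diff[OF this sandwich[of x y]] sandwich[of z y]] show ?thesis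
      by (simp add: algebra_simps)
  qed
  have "P (free_gen x * free_gen y * free_gen z - free_gen y * free_gen x * free_gen z -
      (free_gen z * (free_gen x * free_gen y) - free_gen z * (free_gen y * free_gen x)))" for x y z
    \<comment> \<open>\<open>(xyz + zyx) - (yxz + zxy)\<close> is the expansion of
      \<open>[[x, y], z]\<close>.\<close>
    using diff[OF polar[of x y z] polar[of y x z]] by (simp add: algebra_simps)
  then show ?thesis
    using sandwich by (auto simp: F_relations_eq T_cubes_def P_def)
qed

lemma meson_relations_subset_F_cubes_ideal:
  fixes scale :: "'k::field_char_0 \<Rightarrow> 'e::ab_group_add \<Rightarrow> 'e"
  shows "meson_relations scale \<subseteq> Idl\<^bsub>tensor_algebra scale\<^esub> (F_relations scale \<union> T_cubes scale)"
proof -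
  interpret T: assoc_algebra "tensor_algebra scale" by (rule assoc_algebra_tensor_algebra)
  let ?S = "F_relations scale \<union> T_cubes scale"
  have S: "?S \<subseteq> carrier (tensor_algebra scale)"
    using F_relations_closed T_cubes_closed by blast
  interpret J: ideal "Idl\<^bsub>tensor_algebra scale\<^esub> ?S" "tensor_algebra scale"
    by (rule T.genideal_ideal[OF S])
  define P where "P p \<longleftrightarrow> tensor_proj scale p \<in> Idl\<^bsub>tensor_algebra scale\<^esub> ?S" for p
  have add: "P (p + q)" if "P p" "P q" for p q
    using that by (simp add: P_def tensor_proj_add)
  have diff: "P (p - q)" if "P p" "P q" for p q
    using that by (simp add: P_def tensor_proj_diff a_minus_def)
  have mult: "P (r * p)" if "P p" for r p
    using that by (simp add: P_def tensor_proj_mult J.I_l_closed tensor_proj_closed)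
  have cube: "P (free_gen x * free_gen x * free_gen x)" for x
    unfolding P_def by (rule subsetD[OF T.genideal_self[OF S]]) (simp add: T_cubes_def)
  have double: "P (free_gen x * free_gen y * free_gen z - free_gen y * free_gen x * free_gen z -
      (free_gen z * (free_gen x * free_gen y) - free_gen z * (free_gen y * free_gen x)))" for x y z
    unfolding P_def by (rule subsetD[OF T.genideal_self[OF S]]) (auto simp: F_relations_eq)
  have "P (free_gen x * free_gen y * free_gen x)" for x y
  proof -
    let ?X = "free_gen x :: 'e word \<Rightarrow>\<^sub>0 'k" and ?Y = "free_gen y :: 'e word \<Rightarrow>\<^sub>0 'k"
    have plus: "P ((?X + ?Y) * (?X + ?Y) * (?X + ?Y))"
      using cube[of "x + y"] by (simp add: P_def tensor_proj_mult tensor_proj_gen_add)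
    \<comment> \<open>Additivity for the decomposition \<open>x = (x - y) + y\<close>, solved for
      the first summand.\<close>
    have "tensor_proj scale (free_gen (x - y)) = tensor_proj scale (?X - ?Y)"
      using tensor_proj_gen_add[of scale "x - y" y]
      by (simp add: tensor_proj_add tensor_proj_diff tensor_proj_closed T.minus_eq
          T.a_assoc T.r_neg)
    then have minus: "P ((?X - ?Y) * (?X - ?Y) * (?X - ?Y))"
      using cube[of "x - y"] by (simp add: P_def tensor_proj_mult)
    \<comment> \<open>\<open>?D\<close> is \<open>[[x, y], x] = 2 xyx - yxx - xxy\<close>. The cubes
      below contribute \<open>2 (xxy + xyx + yxx)\<close>, so adding \<open>?D\<close> twice cancels
      everything except \<open>6 xyx\<close>.\<close>
    let ?D = "?X * ?Y * ?X - ?Y * ?X * ?X - (?X * (?X * ?Y) - ?X * (?Y * ?X))"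
    have "P ((?D + ?D) + ((?X + ?Y) * (?X + ?Y) * (?X + ?Y) -
        (?X - ?Y) * (?X - ?Y) * (?X - ?Y) - ?Y * ?Y * ?Y - ?Y * ?Y * ?Y))"
      by (intro add diff plus minus cube double)
    also have "(?D + ?D) + ((?X + ?Y) * (?X + ?Y) * (?X + ?Y) -
        (?X - ?Y) * (?X - ?Y) * (?X - ?Y) - ?Y * ?Y * ?Y - ?Y * ?Y * ?Y) =
      (1 + 1 + 1 + 1 + 1 + 1) * (?X * ?Y * ?X)"
      by (simp only: distrib_right mult_1) (simp add: algebra_simps)
    \<comment> \<open>The integer factor is rewritten as the scalar 6 sitting on the empty word, so
      that a field inverse can act on it.\<close>
    also have "1 + 1 + 1 + 1 + 1 + 1 = (Poly_Mapping.single 0 6 :: 'e word \<Rightarrow>\<^sub>0 'k)"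
      by simp
    \<comment> \<open>Multiplication by a scalar is left multiplication by a constant, hence
      preserves the ideal. Characteristic zero enters here: \<open>1 / 6 * 6\<close> is 1.\<close>
    finally have "P (Poly_Mapping.single 0 (1 / 6) * (Poly_Mapping.single 0 6 * (?X * ?Y * ?X)))"
      by (rule mult)
    also have "Poly_Mapping.single 0 (1 / 6) * (Poly_Mapping.single 0 6 * (?X * ?Y * ?X)) =
        Poly_Mapping.single 0 (1 / 6 * 6) * (?X * ?Y * ?X)"
      by (simp only: mult_single add_0 flip: mult.assoc)
    finally show ?thesis
      by simp
  qed
  then show ?thesis
    by (auto simp: meson_relations_eq P_def)
qed

lemma meson_ideal_eq:
  fixes scale :: "'k::field_char_0 \<Rightarrow> 'e::ab_group_add \<Rightarrow> 'e"
  shows "Idl\<^bsub>tensor_algebra scale\<^esub> meson_relations scale =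
    Idl\<^bsub>tensor_algebra scale\<^esub> (F_relations scale \<union> T_cubes scale)"
proof -
  interpret T: assoc_algebra "tensor_algebra scale" by (rule assoc_algebra_tensor_algebra)
  have S: "F_relations scale \<union> T_cubes scale \<subseteq> carrier (tensor_algebra scale)"
    using F_relations_closed T_cubes_closed by blast
  show ?thesis
    by (intro equalityI T.genideal_minimal T.genideal_ideal S meson_relations_closed
        meson_relations_subset_F_cubes_ideal F_relations_cubes_subset_meson_ideal)
qed

section \<open>The isomorphism induced by the identity of the generating space\<close>

theorem corollary4:
  fixes scale :: "'k::field_char_0 \<Rightarrow> 'e::ab_group_add \<Rightarrow> 'e" and Basis :: "'e set"
  assumes "finite_dimensional_vector_space scale Basis"
  shows "\<exists>\<phi> \<in> algebra_iso (meson_algebra scale)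
                           (quot_algebra (F_algebra scale) (F_cubes scale)).
           (\<forall>x. \<phi> (meson_proj scale (tensor_gen scale x)) =
                quot_proj (F_algebra scale) (F_cubes scale)
                  (F_proj scale (tensor_gen scale x))) \<and>
           (\<forall>t \<in> carrier (tensor_algebra scale).
              \<phi> (meson_proj scale t) =
                quot_proj (F_algebra scale) (F_cubes scale) (F_proj scale t))"
proof -
  let ?T = "tensor_algebra scale" and ?F = "F_algebra scale" and ?C = "F_cubes scale"
  \<comment> \<open>The composite of the two projections from the tensor algebra; the isomorphism
    arises by factoring it through its kernel.\<close>
  let ?h = "\<lambda>t. quot_proj ?F ?C (F_proj scale t)"
  interpret T: assoc_algebra ?T by (rule assoc_algebra_tensor_algebra)
  interpret F: assoc_algebra ?F by (rule assoc_algebra_F_algebra)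
  interpret p: ring_hom_ring ?T ?F "F_proj scale"
    unfolding F_algebra_def F_proj_def
    by (rule T.quot_proj_ring_hom_ring[OF F_relations_closed])
  interpret q: ring_hom_ring ?F "quot_algebra ?F ?C" "quot_proj ?F ?C"
    by (rule F.quot_proj_ring_hom_ring[OF F_cubes_closed])
  have carrier_F: "carrier ?F = F_proj scale ` carrier ?T"
    unfolding F_algebra_def F_proj_def by (rule T.quot_algebra_carrier[OF F_relations_closed])
  have surj: "?h ` carrier ?T = carrier (quot_algebra ?F ?C)"
    by (simp add: F.quot_algebra_carrier[OF F_cubes_closed] carrier_F image_image)
  have smult: "?h (c \<odot>\<^bsub>?T\<^esub> t) = c \<odot>\<^bsub>quot_algebra ?F ?C\<^esub> ?h t" if "t \<in> carrier ?T" for c t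
    using that T.quot_algebra_smult_proj[OF F_relations_closed, of t c]
      F.quot_algebra_smult_proj[OF F_cubes_closed, of "F_proj scale t" c] p.hom_closed[of t]
    by (simp flip: F_algebra_def F_proj_def)
  have hom: "?h \<in> ring_hom ?T (quot_algebra ?F ?C)"
    using ring_hom_trans[OF p.homh q.homh] by (simp add: comp_def)
  \<comment> \<open>The kernel is first found in terms of the double commutators and the cubes;
    \<open>meson_ideal_eq\<close> then exchanges these generators for the meson relations.\<close>
  have "a_kernel ?T (quot_algebra ?F ?C) ?h = Idl\<^bsub>?T\<^esub> (F_relations scale \<union> T_cubes scale)"
    using T.kernel_quot_quot[OF F_relations_closed T_cubes_closed]
    by (simp add: F_cubes_eq F_algebra_def F_proj_def)
  then have ker: "a_kernel ?T (quot_algebra ?F ?C) ?h = Idl\<^bsub>?T\<^esub> meson_relations scale"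
    by (simp only: meson_ideal_eq)
  obtain \<phi> where \<phi>: "\<phi> \<in> algebra_iso (meson_algebra scale) (quot_algebra ?F ?C)"
    and eq: "\<forall>t \<in> carrier ?T. \<phi> (meson_proj scale t) = ?h t"
    unfolding meson_algebra_def meson_proj_def
    by (rule bexE[OF T.quot_algebra_iso[OF meson_relations_closed
        F.quot_algebra_ring[OF F_cubes_closed] hom surj smult ker]])
  have "\<forall>x. \<phi> (meson_proj scale (tensor_gen scale x)) = ?h (tensor_gen scale x)"
    using eq tensor_gen_closed by (intro allI) (rule bspec)
  then show ?thesis
    using eq by (intro bexI[OF _ \<phi>] conjI)
qed

end
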